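(* Let $\sigma=\pm1$, let $q$ be a nowhere vanishing smooth complex-valued function of $x$, and let $\hat{\mathcal L}=-\lambda^2+E\lambda+F$ with $$E=\frac{iq_x}{q},\qquad F=-\tfrac14E^2-\sigma|q|^2+\tfrac i2E'.$$ Let $n\ge0$, let $\phi_n=\sum_{j=0}^nA_j(x)\lambda^{n-j}$ be an $n$-soliton solution associated to $\hat{\mathcal L}$, and let $\mathcal H_n(\lambda)=\phi_n\phi_n''-\frac12(\phi_n')^2-2\hat{\mathcal L}\phi_n^2$. Then: (i) $\mathcal H_n(\lambda)$ is a polynomial in $\lambda$ of degree $2n+2$. (ii) The coefficients satisfy the recursion $$A_j=\frac12\int\big[\langle E,A_{j-1}\rangle+\langle F,A_{j-2}\rangle\big]dx-\frac14A_{j-2}''\qquad (j=1,\dots,n),$$ with $A_{-1}=0$, for suitable constants of integration. (iii) If $A_{n+1}$ and $A_{n+2}$ are defined by the recursion in (ii) with $j=n+1$ and $j=n+2$ (any constants of integration), then the following two conditions hold: Condition A: $A_{n+1}'=0$; Condition B: $-4A_{n+2}'+2A_{n+1}E'=0$.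
   Context: Setting: $x$ ranges over an open interval of $\mathbb R$, all functions of $x$ are smooth and complex valued, $'$ and the subscript $x$ denote $d/dx$, and $\lambda$ is an $x$-independent parameter; identities between polynomials in $\lambda$ are coefficientwise. $\hat{\mathcal L}$ (the spectral operator of the nonlinear Schrödinger equation) acts by multiplication. Bilinear operator: $\langle\psi,\phi\rangle:=\psi'\phi+2\psi\phi'$. An $n$-soliton solution associated to $\hat{\mathcal L}$ is a polynomial $\phi_n(x;\lambda)=\sum_{j=0}^nA_j(x)\lambda^{n-j}$ of degree $n$ in $\lambda$, with $A_0$ a nonzero constant, satisfying $\phi_n'''-2\langle\hat{\mathcal L},\phi_n\rangle=0$. The equality in the recursion is understood up to an additive constant of integration. *)

theory Defs
  imports "HOL-Analysis.Analysis" "HOL-Computational_Algebra.Polynomial"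
begin

definition dx :: "(real \<Rightarrow> complex) \<Rightarrow> real \<Rightarrow> complex" where
  "dx f = (\<lambda>x. vector_derivative f (at x))"

(* Intended for open I, where the iterated derivatives on I depend only on f on I. *)
definition smooth_on :: "real set \<Rightarrow> (real \<Rightarrow> complex) \<Rightarrow> bool" where
  "smooth_on I f \<longleftrightarrow> (\<forall>k. \<forall>x\<in>I. (dx ^^ k) f differentiable (at x))"

(* A polynomial in lambda whose coefficients are functions of x has type real => complex poly
   (the poly variable is lambda); dx_poly differentiates its coefficients in x.  Abs_poly is
   meaningful because the degrees of all polynomials to which dx_poly is applied are bounded
   uniformly in x; see coeff_dx_poly. *)
definition dx_poly :: "(real \<Rightarrow> complex poly) \<Rightarrow> real \<Rightarrow> complex poly" where
  "dx_poly p = (\<lambda>x. Abs_poly (\<lambda>k. dx (\<lambda>t. coeff (p t) k) x))"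

lemma coeff_dx_poly:
  assumes "\<And>t. degree (p t) \<le> N"
  shows "coeff (dx_poly p x) k = dx (\<lambda>t. coeff (p t) k) x"
proof -
  have "dx (\<lambda>t. coeff (p t) i) x = 0" if "i > N" for i
  proof -
    have "(\<lambda>t. coeff (p t) i) = (\<lambda>t. 0)"
      using assms that by (auto intro!: ext coeff_eq_0 intro: le_less_trans)
    then show ?thesis by (simp add: dx_def)
  qed
  then show ?thesis unfolding dx_poly_def by (subst coeff_Abs_poly) auto
qed

(* <psi, phi> = psi' phi + 2 psi phi', where D is the derivative in x: D = dx for functions
   of x, D = dx_poly for polynomials in lambda. *)
definition bilin ::
    "((real \<Rightarrow> 'a) \<Rightarrow> real \<Rightarrow> 'a) \<Rightarrow> (real \<Rightarrow> 'a) \<Rightarrow> (real \<Rightarrow> 'a) \<Rightarrow> real \<Rightarrow> 'a::comm_ring_1" where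
  "bilin D \<psi> \<phi> = (\<lambda>x. D \<psi> x * \<phi> x + 2 * \<psi> x * D \<phi> x)"

definition nls_E :: "(real \<Rightarrow> complex) \<Rightarrow> real \<Rightarrow> complex" where
  "nls_E q = (\<lambda>x. \<i> * dx q x / q x)"

definition nls_F :: "complex \<Rightarrow> (real \<Rightarrow> complex) \<Rightarrow> real \<Rightarrow> complex" where
  "nls_F \<sigma> q = (\<lambda>x. - (1/4) * (nls_E q x)^2 - \<sigma> * of_real ((cmod (q x))^2)
                      + (\<i>/2) * dx (nls_E q) x)"

definition nls_L :: "complex \<Rightarrow> (real \<Rightarrow> complex) \<Rightarrow> real \<Rightarrow> complex poly" where
  "nls_L \<sigma> q = (\<lambda>x. [:nls_F \<sigma> q x, nls_E q x, -1:])"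

definition soliton_poly :: "nat \<Rightarrow> (nat \<Rightarrow> real \<Rightarrow> complex) \<Rightarrow> real \<Rightarrow> complex poly" where
  "soliton_poly n A = (\<lambda>x. \<Sum>j\<le>n. monom (A j x) (n - j))"

(* Only A 0, ..., A n are constrained; A (n+1), A (n+2), ... remain arbitrary. *)
definition soliton_solution ::
    "real set \<Rightarrow> (real \<Rightarrow> complex poly) \<Rightarrow> nat \<Rightarrow> (nat \<Rightarrow> real \<Rightarrow> complex) \<Rightarrow> bool" where
  "soliton_solution I L n A \<longleftrightarrow>
     (\<forall>j\<le>n. smooth_on I (A j)) \<and>
     (\<exists>c. c \<noteq> 0 \<and> (\<forall>x\<in>I. A 0 x = c)) \<and>
     (let \<phi> = soliton_poly n A in
        \<forall>x\<in>I. dx_poly (dx_poly (dx_poly \<phi>)) x - 2 * bilin dx_poly L \<phi> x = 0)"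

definition H_poly ::
    "(real \<Rightarrow> complex poly) \<Rightarrow> (real \<Rightarrow> complex poly) \<Rightarrow> real \<Rightarrow> complex poly" where
  "H_poly L \<phi> = (\<lambda>x. \<phi> x * dx_poly (dx_poly \<phi>) x - smult (1/2) ((dx_poly \<phi> x)^2)
                     - 2 * L x * (\<phi> x)^2)"

(* A_{j-2} for j >= 1, with the convention A_{-1} = 0. *)
definition two_before :: "(nat \<Rightarrow> real \<Rightarrow> complex) \<Rightarrow> nat \<Rightarrow> real \<Rightarrow> complex" where
  "two_before A j = (if j \<ge> 2 then A (j - 2) else (\<lambda>_. 0))"

(* The recursion for A_j (j >= 1).  The indefinite integral is an antiderivative G on the
   interval I; the existential quantifier over G is the choice of the constant of integration. *)
definition recursion ::
    "real set \<Rightarrow> (real \<Rightarrow> complex) \<Rightarrow> (real \<Rightarrow> complex) \<Rightarrow> (nat \<Rightarrow> real \<Rightarrow> complex) \<Rightarrow> nat \<Rightarrow> bool" where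
  "recursion I E F A j \<longleftrightarrow>
     (\<exists>G. (\<forall>x\<in>I. (G has_vector_derivative
                     bilin dx E (A (j - 1)) x + bilin dx F (two_before A j) x) (at x)) \<and>
          (\<forall>x\<in>I. A j x = (1/2) * G x - (1/4) * dx (dx (two_before A j)) x))"

end

theory Submission
  imports Defs
begin

text \<open>
  Everything is read off from the single identity \<open>\<phi>''' = 2 \<langle>L, \<phi>\<rangle>\<close>.

  Multiplied by \<open>\<phi>\<close>, it says that the \<open>x\<close>-derivative of
  \<open>\<phi> \<phi>'' - \<phi>'\<^sup>2 / 2 - 2 L \<phi>\<^sup>2\<close> vanishes, so this expression is a first integral
  (\<open>first_integral_derivative\<close>). To avoid differentiating products of polynomials coefficientwise,
  \<open>\<lambda>\<close> is fixed at a complex number \<open>z\<close>: the value at every \<open>z\<close> is constant on the interval, and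
  a polynomial is determined by its values. The degree comes from \<open>-2 L \<phi>\<^sup>2\<close> alone, whose leading
  term is \<open>2 A\<^sub>0\<^sup>2 \<lambda>\<^bsup>2 n + 2\<^esup>\<close>; the derivatives contribute degree at most \<open>2 n\<close>.

  Since \<open>L = - \<lambda>\<^sup>2 + E \<lambda> + F\<close>, the coefficient of \<open>\<lambda>\<^bsup>n + 2 - j\<^esup>\<close> in the identity is
  \<open>A\<^sub>j\<^sub>-\<^sub>2''' + 4 A\<^sub>j' - 2 \<langle>E, A\<^sub>j\<^sub>-\<^sub>1\<rangle> - 2 \<langle>F, A\<^sub>j\<^sub>-\<^sub>2\<rangle> = 0\<close>, where \<open>A\<^sub>-\<^sub>1 = 0\<close>
  and terms with coefficients beyond \<open>A\<^sub>n\<close> are absent (\<open>soliton_coefficient_identity\<close>). For \<open>j \<le> n\<close> this is the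
  differentiated recursion. For \<open>j = n + 1\<close> the term \<open>4 A\<^sub>j'\<close> is missing, so a function \<open>A\<^sub>n\<^sub>+\<^sub>1\<close>
  obtained from the recursion must have derivative zero. For \<open>j = n + 2\<close> also
  \<open>\<langle>E, A\<^sub>n\<^sub>+\<^sub>1\<rangle>\<close> is missing; hence \<open>4 A\<^sub>n\<^sub>+\<^sub>2' = 2 \<langle>E, A\<^sub>n\<^sub>+\<^sub>1\<rangle>\<close>, which equals
  \<open>2 E' A\<^sub>n\<^sub>+\<^sub>1\<close> because \<open>A\<^sub>n\<^sub>+\<^sub>1' = 0\<close>.
\<close>

section \<open>Differentiation of functions and of polynomial families\<close>

lemma dx_eqI: "(f has_vector_derivative d) (at x) \<Longrightarrow> dx f x = d"
  by (simp add: dx_def vector_derivative_at)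

lemma dx_zero [simp]: "dx (\<lambda>_. 0) = (\<lambda>_. 0)"
  by (simp add: dx_def)

lemma smooth_on_has_vector_derivative:
  assumes "smooth_on I f" "x \<in> I"
  shows "(f has_vector_derivative dx f x) (at x)"
  using assms(1)[unfolded smooth_on_def, rule_format, OF assms(2), of 0]
  by (simp add: dx_def vector_derivative_works)

lemma smooth_on_dx: "smooth_on I f \<Longrightarrow> smooth_on I (dx f)"
  unfolding smooth_on_def by (metis comp_apply funpow_Suc_right)

lemma smooth_on_zero: "smooth_on I (\<lambda>_. 0)"
proof -
  have "(dx ^^ k) (\<lambda>_. 0) = (\<lambda>_. 0)" for k by (induction k) simp_all
  then show ?thesis by (simp add: smooth_on_def)
qed

lemma coeff_soliton_poly:
  "coeff (soliton_poly n A x) k = (if k \<le> n then A (n - k) x else 0)"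
proof -
  have "coeff (soliton_poly n A x) k = (\<Sum>j\<le>n. if n - j = k then A j x else 0)"
    by (simp add: soliton_poly_def coeff_sum)
  also have "\<dots> = (\<Sum>j\<le>n. if j = n - k then (if k \<le> n then A j x else 0) else 0)"
    by (rule sum.cong) auto
  finally show ?thesis by simp
qed

lemma degree_soliton_poly_le: "degree (soliton_poly n A x) \<le> n"
  by (rule degree_le) (simp add: coeff_soliton_poly)

lemma dx_poly_soliton_poly: "dx_poly (soliton_poly n A) = soliton_poly n (\<lambda>j. dx (A j))"
  by (intro ext poly_eqI) (simp add: coeff_dx_poly[OF degree_soliton_poly_le] coeff_soliton_poly)

lemma has_vector_derivative_poly_soliton_poly:
  assumes "\<forall>j\<le>n. smooth_on I (A j)" "x \<in> I"
  shows "((\<lambda>t. poly (soliton_poly n A t) z) has_vector_derivative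
            poly (dx_poly (soliton_poly n A) x) z) (at x)"
  unfolding dx_poly_soliton_poly unfolding soliton_poly_def poly_sum poly_monom
  using assms by (auto intro!: derivative_intros smooth_on_has_vector_derivative)

section \<open>The spectral operator\<close>

lemma dx_poly_nls_L: "dx_poly (nls_L \<sigma> q) x = [:dx (nls_F \<sigma> q) x, dx (nls_E q) x:]"
proof -
  have deg: "degree (nls_L \<sigma> q t) \<le> 2" for t by (simp add: nls_L_def)
  show ?thesis
    by (rule poly_eqI)
       (simp add: coeff_dx_poly[OF deg], simp add: nls_L_def coeff_pCons dx_def split: nat.split)
qed

lemma has_vector_derivative_nls_E:
  assumes "smooth_on I q" "x \<in> I" "q x \<noteq> 0"
  shows "(nls_E q has_vector_derivative
            \<i> * (dx (dx q) x * q x - dx q x * dx q x) / (q x * q x)) (at x)"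
proof -
  have "(dx q has_derivative (\<lambda>h. h *\<^sub>R dx (dx q) x)) (at x)"
    "(q has_derivative (\<lambda>h. h *\<^sub>R dx q x)) (at x)"
    using smooth_on_has_vector_derivative[OF smooth_on_dx[OF assms(1)] assms(2)]
      smooth_on_has_vector_derivative[OF assms(1,2)]
    by (simp_all add: has_vector_derivative_def)
  then have "((\<lambda>t. \<i> * dx q t / q t) has_derivative
      (\<lambda>h. (\<i> * (h *\<^sub>R dx (dx q) x) * q x - \<i> * dx q x * (h *\<^sub>R dx q x)) / (q x * q x))) (at x)"
    by (intro has_derivative_divide' has_derivative_mult_right assms(3))
  then show ?thesis
    unfolding nls_E_def has_vector_derivative_def
    by (rule has_derivative_eq_rhs) (auto simp: scaleR_conv_of_real algebra_simps diff_divide_distrib)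
qed

text \<open>As \<open>F\<close> contains \<open>E'\<close>, its derivative requires the second derivative of \<open>E\<close>. The quotient
  formula for \<open>E'\<close> holds only where \<open>q\<close> is differentiable and nonzero, so differentiating it at a
  point uses that the interval is a neighbourhood of that point.\<close>
lemma has_vector_derivative_nls_F:
  assumes "open I" "smooth_on I q" "\<forall>x\<in>I. q x \<noteq> 0" "x \<in> I"
  shows "(nls_F \<sigma> q has_vector_derivative dx (nls_F \<sigma> q) x) (at x)"
proof -
  let ?R = "\<lambda>t. \<i> * (dx (dx q) t * q t - dx q t * dx q t) / (q t * q t)"
  have E: "(nls_E q has_vector_derivative ?R t) (at t)" if "t \<in> I" for t
    using has_vector_derivative_nls_E[of I q t] assms that by blast
  note q0 = smooth_on_has_vector_derivative[OF assms(2,4)]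
  note q1 = smooth_on_has_vector_derivative[OF smooth_on_dx[OF assms(2)] assms(4)]
  note q2 = smooth_on_has_vector_derivative[OF smooth_on_dx[OF smooth_on_dx[OF assms(2)]] assms(4)]
  have "?R differentiable (at x)"
    using differentiableI_vector[OF q0] differentiableI_vector[OF q1] differentiableI_vector[OF q2]
      assms(3,4)
    by (intro differentiable_divide differentiable_mult differentiable_diff differentiable_const) auto
  then have "(?R has_vector_derivative dx ?R x) (at x)"
    by (simp add: dx_def vector_derivative_works)
  then have dE: "(dx (nls_E q) has_vector_derivative dx ?R x) (at x)"
    by (rule has_vector_derivative_transform_within_open[OF _ assms(1,4)])
       (simp add: dx_eqI[OF E])
  have "nls_F \<sigma> q = (\<lambda>t. - (1/4) * (nls_E q t * nls_E q t) - \<sigma> * (q t * cnj (q t))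
      + (\<i>/2) * dx (nls_E q) t)"
    unfolding nls_F_def complex_norm_square power2_eq_square[of "nls_E q _"] ..
  then have "\<exists>d. (nls_F \<sigma> q has_vector_derivative d) (at x)"
    by (simp only:) (rule exI, (rule derivative_intros E[OF assms(4)] q0 dE)+)
  then show ?thesis using dx_eqI by metis
qed

lemma has_vector_derivative_poly_nls_L:
  assumes "open I" "smooth_on I q" "\<forall>x\<in>I. q x \<noteq> 0" "x \<in> I"
  shows "((\<lambda>t. poly (nls_L \<sigma> q t) z) has_vector_derivative
            poly (dx_poly (nls_L \<sigma> q) x) z) (at x)"
proof -
  have "(nls_E q has_vector_derivative dx (nls_E q) x) (at x)"
    using has_vector_derivative_nls_E[of I q x] assms dx_eqI by metis
  moreover note has_vector_derivative_nls_F[OF assms, of \<sigma>]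
  ultimately show ?thesis
    unfolding dx_poly_nls_L unfolding nls_L_def
    by (auto intro!: derivative_eq_intros)
qed

section \<open>The first integral\<close>

text \<open>All terms without a third derivative of \<open>f\<close> combine to \<open>- 2 f (l' f + 2 l f')\<close>, since
  \<open>f' f''\<close> cancels.\<close>
lemma first_integral_derivative:
  fixes f f1 f2 l :: "real \<Rightarrow> complex"
  assumes "(f has_vector_derivative f1 x) (at x)"
    and "(f1 has_vector_derivative f2 x) (at x)"
    and "(f2 has_vector_derivative f3) (at x)"
    and "(l has_vector_derivative l1) (at x)"
    and "f3 = 2 * (l1 * f x + 2 * l x * f1 x)"
  shows "((\<lambda>t. f t * f2 t - (1/2) * (f1 t)^2 - 2 * l t * (f t)^2) has_vector_derivative 0) (at x)"
  unfolding power2_eq_square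
  by (rule has_vector_derivative_eq_rhs, (rule derivative_intros assms(1-4))+)
     (simp add: assms(5) algebra_simps)

lemma H_poly_constant:
  assumes I: "open I" "is_interval I" "I \<noteq> {}"
    and q: "smooth_on I q" "\<forall>x\<in>I. q x \<noteq> 0"
    and sol: "soliton_solution I (nls_L \<sigma> q) n A"
  shows "\<exists>P. \<forall>x\<in>I. H_poly (nls_L \<sigma> q) (soliton_poly n A) x = P"
proof -
  let ?L = "nls_L \<sigma> q" and ?\<phi> = "soliton_poly n A"
  have A: "\<forall>j\<le>n. smooth_on I (A j)"
    and eq: "\<And>x. x \<in> I \<Longrightarrow> dx_poly (dx_poly (dx_poly ?\<phi>)) x = 2 * bilin dx_poly ?L ?\<phi> x"
    using sol by (simp_all add: soliton_solution_def Let_def)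
  have A1: "\<forall>j\<le>n. smooth_on I (dx (A j))" and A2: "\<forall>j\<le>n. smooth_on I (dx (dx (A j)))"
    using A by (simp_all add: smooth_on_dx)
  have deriv: "((\<lambda>t. poly (H_poly ?L ?\<phi> t) z) has_vector_derivative 0) (at x)"
    if x: "x \<in> I" for x z
  proof -
    have d1: "((\<lambda>t. poly (?\<phi> t) z) has_vector_derivative poly (dx_poly ?\<phi> x) z) (at x)"
      by (rule has_vector_derivative_poly_soliton_poly[OF A x])
    have d2: "((\<lambda>t. poly (dx_poly ?\<phi> t) z) has_vector_derivative
                poly (dx_poly (dx_poly ?\<phi>) x) z) (at x)"
      using has_vector_derivative_poly_soliton_poly[OF A1 x, of z]
      by (simp add: dx_poly_soliton_poly)
    have d3: "((\<lambda>t. poly (dx_poly (dx_poly ?\<phi>) t) z) has_vector_derivative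
                poly (dx_poly (dx_poly (dx_poly ?\<phi>)) x) z) (at x)"
      using has_vector_derivative_poly_soliton_poly[OF A2 x, of z]
      by (simp add: dx_poly_soliton_poly)
    have "poly (dx_poly (dx_poly (dx_poly ?\<phi>)) x) z =
        2 * (poly (dx_poly ?L x) z * poly (?\<phi> x) z
             + 2 * poly (?L x) z * poly (dx_poly ?\<phi> x) z)"
      unfolding eq[OF x] by (simp add: bilin_def)
    from first_integral_derivative[OF d1 d2 d3 has_vector_derivative_poly_nls_L[OF I(1) q x] this]
    show ?thesis by (simp add: H_poly_def)
  qed
  obtain x0 where x0: "x0 \<in> I" using I(3) by blast
  have "H_poly ?L ?\<phi> x = H_poly ?L ?\<phi> x0" if x: "x \<in> I" for x
  proof -
    have "poly (H_poly ?L ?\<phi> x) z = poly (H_poly ?L ?\<phi> x0) z" for z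
    proof -
      have "\<exists>c. \<forall>t\<in>I. poly (H_poly ?L ?\<phi> t) z = c"
        using has_vector_derivative_zero_constant[of I "\<lambda>t. poly (H_poly ?L ?\<phi> t) z"]
          is_interval_convex[OF I(2)] has_vector_derivative_at_within[OF deriv] by metis
      with x x0 show ?thesis by metis
    qed
    then show ?thesis by (simp add: poly_eq_poly_eq_iff[symmetric] fun_eq_iff)
  qed
  then show ?thesis by blast
qed

lemma degree_H_poly:
  assumes "A 0 x \<noteq> 0"
  shows "degree (H_poly (nls_L \<sigma> q) (soliton_poly n A) x) = 2 * n + 2"
proof -
  let ?\<phi> = "soliton_poly n A"
  let ?R = "?\<phi> x * dx_poly (dx_poly ?\<phi>) x - smult (1/2) ((dx_poly ?\<phi> x)^2)"
  let ?M = "- (2 * nls_L \<sigma> q x * (?\<phi> x)^2)"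
  have "coeff (?\<phi> x) n \<noteq> 0" using assms by (simp add: coeff_soliton_poly)
  then have deg: "degree (?\<phi> x) = n" and nz: "?\<phi> x \<noteq> 0"
    using degree_soliton_poly_le[of n A x] le_degree[of "?\<phi> x" n] by auto
  have "?M = smult (-2) (nls_L \<sigma> q x * (?\<phi> x)^2)"
    by (simp add: numeral_poly)
  moreover have "nls_L \<sigma> q x \<noteq> 0" "degree (nls_L \<sigma> q x) = 2"
    by (simp_all add: nls_L_def)
  ultimately have M: "degree ?M = 2 * n + 2"
    using nz deg by (simp add: degree_mult_eq degree_power_eq)
  have "degree ?R \<le> n + n"
    unfolding dx_poly_soliton_poly power2_eq_square
    by (intro degree_diff_le order.trans[OF degree_smult_le] order.trans[OF degree_mult_le]
        add_mono degree_soliton_poly_le)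
  with M have "degree (?R + ?M) = 2 * n + 2"
    by (subst degree_add_eq_right) auto
  then show ?thesis by (simp add: H_poly_def)
qed

section \<open>The coefficients of the soliton equation\<close>

text \<open>The coefficient of \<open>\<lambda>\<^bsup>n + 2 - j\<^esup>\<close>. The two cut-offs express that the polynomial ends
  with \<open>A\<^sub>n\<close>; they are the source of Conditions A and B.\<close>
lemma soliton_coefficient_identity:
  assumes sol: "soliton_solution I (nls_L \<sigma> q) n A" and x: "x \<in> I"
    and j: "1 \<le> j" "j \<le> n + 2"
  shows "dx (dx (dx (two_before A j))) x + 4 * (if j \<le> n then dx (A j) x else 0)
      = 2 * ((if j \<le> n + 1 then bilin dx (nls_E q) (A (j - 1)) x else 0)
             + bilin dx (nls_F \<sigma> q) (two_before A j) x)"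
proof -
  let ?E = "nls_E q" and ?F = "nls_F \<sigma> q" and ?\<phi> = "soliton_poly n A"
  let ?p = "?\<phi> x" and ?p1 = "dx_poly ?\<phi> x"
  define k where "k = n + 2 - j"
  have "dx_poly (dx_poly (dx_poly ?\<phi>)) x = 2 * bilin dx_poly (nls_L \<sigma> q) ?\<phi> x"
    using sol x by (simp add: soliton_solution_def Let_def)
  also have "\<dots> = smult 2 ([:dx ?F x, dx ?E x:] * ?p + smult 2 ([:?F x, ?E x, -1:] * ?p1))"
    by (simp only: bilin_def dx_poly_nls_L) (simp add: nls_L_def numeral_poly smult_add_right mult_ac)
  finally have eq: "coeff (dx_poly (dx_poly (dx_poly ?\<phi>)) x) k =
      coeff (smult 2 ([:dx ?F x, dx ?E x:] * ?p + smult 2 ([:?F x, ?E x, -1:] * ?p1))) k"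
    by simp
  \<comment> \<open>The factor \<open>\<lambda>\<^sup>2\<close> contributes nothing to the exponents \<open>0\<close> and \<open>1\<close>, and the factor \<open>\<lambda>\<close>
      nothing to the exponent \<open>0\<close>; this is what the cut-offs record.\<close>
  consider "k = 0" "j = n + 2" | "k = 1" "j = n + 1" | m where "k = m + 2" "j + m = n"
  proof -
    have "k = 0 \<and> j = n + 2 \<or> k = 1 \<and> j = n + 1 \<or> k = (k - 2) + 2 \<and> j + (k - 2) = n"
      using j unfolding k_def by auto
    then show thesis using that by blast
  qed
  then show ?thesis
  proof cases
    case 1
    with eq show ?thesis
      by (simp add: dx_poly_soliton_poly coeff_soliton_poly two_before_def bilin_def)
  next
    case 2
    with eq show ?thesis
      by (cases n) (simp_all add: dx_poly_soliton_poly coeff_soliton_poly two_before_def bilin_def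
          algebra_simps)
  next
    case (3 m)
    show ?thesis
    proof (cases "j = 1")
      case True
      with 3 eq show ?thesis
        by (auto simp: dx_poly_soliton_poly coeff_soliton_poly two_before_def bilin_def
            algebra_simps)
    next
      case False
      with j have "j = (j - 2) + 2" by simp
      then obtain i where "j = i + 2" by blast
      moreover from this 3 have "n = i + 2 + m" by simp
      ultimately show ?thesis
        using 3(1) eq
        by (simp add: dx_poly_soliton_poly coeff_soliton_poly two_before_def bilin_def algebra_simps)
    qed
  qed
qed

section \<open>The recursion and Conditions A and B\<close>

lemma soliton_recursion:
  assumes sol: "soliton_solution I (nls_L \<sigma> q) n A" and j: "1 \<le> j" "j \<le> n"
  shows "recursion I (nls_E q) (nls_F \<sigma> q) A j"
proof -
  let ?T = "two_before A j"
  have smooth: "\<forall>j\<le>n. smooth_on I (A j)"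
    using sol by (simp add: soliton_solution_def)
  then have T: "smooth_on I ?T"
    using j by (simp add: two_before_def smooth_on_zero)
  define G where "G = (\<lambda>x. 2 * A j x + (1/2) * dx (dx ?T) x)"
  have "(G has_vector_derivative
          bilin dx (nls_E q) (A (j - 1)) x + bilin dx (nls_F \<sigma> q) ?T x) (at x)"
    if x: "x \<in> I" for x
  proof -
    have "(G has_vector_derivative 2 * dx (A j) x + (1/2) * dx (dx (dx ?T)) x) (at x)"
      unfolding G_def using smooth j T x
      by (intro has_vector_derivative_add has_vector_derivative_mult_right
          smooth_on_has_vector_derivative[of I]) (auto intro: smooth_on_dx)
    then show ?thesis
      by (rule has_vector_derivative_eq_rhs)
         (use soliton_coefficient_identity[OF sol x, of j] j in \<open>simp add: field_simps\<close>)
  qed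
  moreover have "A j x = (1/2) * G x - (1/4) * dx (dx ?T) x" for x
    by (simp add: G_def algebra_simps add_divide_distrib)
  ultimately show ?thesis unfolding recursion_def by blast
qed

lemma dx_of_recursion:
  assumes "open I" and rec: "recursion I E F A j" and T: "smooth_on I (two_before A j)"
    and x: "x \<in> I"
  shows "4 * dx (A j) x =
    2 * (bilin dx E (A (j - 1)) x + bilin dx F (two_before A j) x) - dx (dx (dx (two_before A j))) x"
proof -
  let ?T = "two_before A j"
  obtain G where G: "\<forall>x\<in>I. (G has_vector_derivative
        bilin dx E (A (j - 1)) x + bilin dx F ?T x) (at x)"
    and A: "\<And>x. x \<in> I \<Longrightarrow> A j x = (1/2) * G x - (1/4) * dx (dx ?T) x"
    using rec unfolding recursion_def by blast
  have "((\<lambda>x. (1/2) * G x - (1/4) * dx (dx ?T) x) has_vector_derivative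
      (1/2) * (bilin dx E (A (j - 1)) x + bilin dx F ?T x) - (1/4) * dx (dx (dx ?T)) x) (at x)"
    using G T x
    by (intro has_vector_derivative_diff has_vector_derivative_mult_right
        smooth_on_has_vector_derivative[of I]) (auto intro: smooth_on_dx)
  then have "(A j has_vector_derivative
      (1/2) * (bilin dx E (A (j - 1)) x + bilin dx F ?T x) - (1/4) * dx (dx (dx ?T)) x) (at x)"
    by (rule has_vector_derivative_transform_within_open[OF _ \<open>open I\<close> x]) (simp add: A)
  from dx_eqI[OF this] show ?thesis by (simp only:) (simp add: algebra_simps)
qed

lemma conditions_A_B:
  assumes "open I" and sol: "soliton_solution I (nls_L \<sigma> q) n A"
    and A': "\<And>j. j \<le> n \<Longrightarrow> A' j = A j"
    and rec1: "recursion I (nls_E q) (nls_F \<sigma> q) A' (n + 1)"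
    and rec2: "recursion I (nls_E q) (nls_F \<sigma> q) A' (n + 2)"
    and x: "x \<in> I"
  shows "dx (A' (n + 1)) x = 0"
    and "- 4 * dx (A' (n + 2)) x + 2 * A' (n + 1) x * dx (nls_E q) x = 0"
proof -
  have smooth: "\<forall>j\<le>n. smooth_on I (A j)"
    using sol by (simp add: soliton_solution_def)
  have T: "two_before A' j = two_before A j" if "j \<le> n + 2" for j
    using that by (simp add: two_before_def A')
  have sm: "smooth_on I (two_before A j)" if "j \<le> n + 2" for j
    using that smooth by (simp add: two_before_def smooth_on_zero)
  show A: "dx (A' (n + 1)) x = 0"
    using dx_of_recursion[OF \<open>open I\<close> rec1 _ x]
      soliton_coefficient_identity[OF sol x, of "n + 1"] T[of "n + 1"] sm[of "n + 1"]
    by (simp add: A')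
  have "4 * dx (A' (n + 2)) x = 2 * bilin dx (nls_E q) (A' (n + 1)) x"
    using dx_of_recursion[OF \<open>open I\<close> rec2 _ x]
      soliton_coefficient_identity[OF sol x, of "n + 2"] T[of "n + 2"] sm[of "n + 2"]
    by simp
  with A show "- 4 * dx (A' (n + 2)) x + 2 * A' (n + 1) x * dx (nls_E q) x = 0"
    by (simp add: bilin_def algebra_simps)
qed

theorem theorem3p3:
  fixes I :: "real set" and \<sigma> :: complex and q :: "real \<Rightarrow> complex"
    and n :: nat and A :: "nat \<Rightarrow> real \<Rightarrow> complex"
  assumes "open I" and "is_interval I" and "I \<noteq> {}"
    and "\<sigma> = 1 \<or> \<sigma> = -1"
    and "smooth_on I q" and "\<forall>x\<in>I. q x \<noteq> 0"
    and "soliton_solution I (nls_L \<sigma> q) n A"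
  shows "(\<exists>P :: complex poly. degree P = 2 * n + 2 \<and>
            (\<forall>x\<in>I. H_poly (nls_L \<sigma> q) (soliton_poly n A) x = P))
    \<and> (\<forall>j\<in>{1..n}. recursion I (nls_E q) (nls_F \<sigma> q) A j)
    \<and> (\<forall>B C. let A' = A(n + 1 := B, n + 2 := C) in
          recursion I (nls_E q) (nls_F \<sigma> q) A' (n + 1) \<longrightarrow>
          recursion I (nls_E q) (nls_F \<sigma> q) A' (n + 2) \<longrightarrow>
          (\<forall>x\<in>I. dx (A' (n + 1)) x = 0) \<and>
          (\<forall>x\<in>I. - 4 * dx (A' (n + 2)) x + 2 * A' (n + 1) x * dx (nls_E q) x = 0))"
proof (intro conjI allI ballI)
  obtain x0 where x0: "x0 \<in> I" using assms(3) by blast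
  then have "A 0 x0 \<noteq> 0" using assms(7) by (auto simp: soliton_solution_def)
  then show "\<exists>P. degree P = 2 * n + 2 \<and>
      (\<forall>x\<in>I. H_poly (nls_L \<sigma> q) (soliton_poly n A) x = P)"
    using degree_H_poly H_poly_constant[OF assms(1-3,5-7)] x0 by metis
next
  fix j assume "j \<in> {1..n}"
  then show "recursion I (nls_E q) (nls_F \<sigma> q) A j"
    using soliton_recursion[OF assms(7)] by simp
next
  fix B C
  let ?A' = "A(n + 1 := B, n + 2 := C)"
  have "\<And>j. j \<le> n \<Longrightarrow> ?A' j = A j" by simp
  from conditions_A_B[OF assms(1,7) this]
  show "let A' = ?A' in
      recursion I (nls_E q) (nls_F \<sigma> q) A' (n + 1) \<longrightarrow>
      recursion I (nls_E q) (nls_F \<sigma> q) A' (n + 2) \<longrightarrow>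
      (\<forall>x\<in>I. dx (A' (n + 1)) x = 0) \<and>
      (\<forall>x\<in>I. - 4 * dx (A' (n + 2)) x + 2 * A' (n + 1) x * dx (nls_E q) x = 0)"
    unfolding Let_def by blast
qed

end
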